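(* Let $G$ be a solvable group of derived length $k$, and let $A$ be an abelian group. Then $A \wr G$ is a solvable group of derived length $k+1$. Furthermore, if $G$ is infinite, then $A \wr G$ is not polycyclic.
   Context: $A \wr G$ denotes the restricted wreath product $A^G\rtimes G$, where $A^G=\bigoplus_{g\in G}A$ is the group of finitely supported functions $G\to A$, on which $G$ acts by left translation of coordinates.
   Formalization: The abelian group A is assumed to be nontrivial; for trivial A the wreath product is isomorphic to G, so its derived length is k rather than k+1, and for G = Z it is polycyclic. *)

theory Defs
  imports "HOL-Algebra.Algebra"
begin

definition semidirect_product ::
    "('n, 'a) monoid_scheme \<Rightarrow> ('h, 'b) monoid_scheme \<Rightarrow> ('h \<Rightarrow> 'n \<Rightarrow> 'n) \<Rightarrow> ('n \<times> 'h) monoid"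
  where "semidirect_product N H \<phi> =
    \<lparr>carrier = carrier N \<times> carrier H,
     monoid.mult = (\<lambda>(n, h) (n', h'). (n \<otimes>\<^bsub>N\<^esub> \<phi> h n', h \<otimes>\<^bsub>H\<^esub> h')),
     one = (\<one>\<^bsub>N\<^esub>, \<one>\<^bsub>H\<^esub>)\<rparr>"

definition left_translate :: "('g, 'm) monoid_scheme \<Rightarrow> 'g \<Rightarrow> ('g \<Rightarrow> 'a) \<Rightarrow> ('g \<Rightarrow> 'a)"
  where "left_translate G g f = (\<lambda>x\<in>carrier G. f (inv\<^bsub>G\<^esub> g \<otimes>\<^bsub>G\<^esub> x))"

(* The base group is the library's restricted direct sum: finitely supported functions on
   carrier G with values in carrier A, represented extensionally (undefined off carrier G). *)
definition restricted_wreath ::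
    "('a, 'l) monoid_scheme \<Rightarrow> ('g, 'm) monoid_scheme \<Rightarrow> (('g \<Rightarrow> 'a) \<times> 'g) monoid"
  where "restricted_wreath A G =
    semidirect_product (sum_group (carrier G) (\<lambda>_. A)) G (left_translate G)"

(* Only meaningful for solvable G; otherwise the set of such n is empty. *)
definition derived_length :: "('a, 'b) monoid_scheme \<Rightarrow> nat"
  where "derived_length G = (LEAST n. (derived G ^^ n) (carrier G) = {\<one>\<^bsub>G\<^esub>})"

(* Finite subnormal series from the trivial subgroup up to H with cyclic factors,
   in the style of solvable_seq. *)
inductive polycyclic_seq :: "('a, 'b) monoid_scheme \<Rightarrow> 'a set \<Rightarrow> bool"
  for G where
    unity: "polycyclic_seq G {\<one>\<^bsub>G\<^esub>}"
  | extension: "\<lbrakk> polycyclic_seq G K; K \<lhd> (G \<lparr> carrier := H \<rparr>); subgroup H G;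
                  cyclic_group ((G \<lparr> carrier := H \<rparr>) Mod K) \<rbrakk> \<Longrightarrow> polycyclic_seq G H"

definition polycyclic :: "('a, 'b) monoid_scheme \<Rightarrow> bool"
  where "polycyclic G \<longleftrightarrow> polycyclic_seq G (carrier G)"

end

theory Submission
  imports Defs
begin

text \<open>
  The projection onto \<open>G\<close> maps the \<open>k\<close>-th derived subgroup of \<open>A \<wr> G\<close> to the trivial group, so
  that subgroup lies in the abelian base group and the derived length is at most \<open>k + 1\<close>.  For the
  lower bound, write \<open>D n\<close> for the \<open>n\<close>-th derived subgroup of \<open>G\<close>.  Start from a function \<open>b\<close> supported
  at the identity and at step \<open>n\<close> replace \<open>b\<close> by the commutator \<open>(g b) b\<inverse>\<close> of \<open>b\<close> and a lift of some
  \<open>g \<in> D n - D (n + 1)\<close>.  Inductively \<open>b\<close> is nontrivial at the identity and trivial on the rest of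
  \<open>D n\<close>, so the translate \<open>g b\<close> is trivial on \<open>D (n + 1)\<close> and the property persists; hence the
  \<open>k\<close>-th derived subgroup is nontrivial.  Finally, all subgroups of a polycyclic group are finitely
  generated, but the base group is not when \<open>G\<close> is infinite: finitely many functions have a finite
  joint support.
\<close>

section \<open>Semidirect products\<close>

lemma carrier_semidirect_product [simp]:
  "carrier (semidirect_product N H \<phi>) = carrier N \<times> carrier H"
  by (simp add: semidirect_product_def)

lemma one_semidirect_product [simp]:
  "\<one>\<^bsub>semidirect_product N H \<phi>\<^esub> = (\<one>\<^bsub>N\<^esub>, \<one>\<^bsub>H\<^esub>)"
  by (simp add: semidirect_product_def)

lemma mult_semidirect_product [simp]:
  "(n, h) \<otimes>\<^bsub>semidirect_product N H \<phi>\<^esub> (n', h') = (n \<otimes>\<^bsub>N\<^esub> \<phi> h n', h \<otimes>\<^bsub>H\<^esub> h')"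
  by (simp add: semidirect_product_def)

text \<open>Endomorphisms suffice in \<open>hom\<close>: by \<open>one\<close> and
  \<open>mult\<close> the map of \<open>inv h\<close> inverts that of \<open>h\<close> on
  \<open>carrier N\<close>, so the action is by automorphisms.\<close>

lemma group_semidirect_product:
  assumes "group N" "group H"
    and hom: "\<And>h. h \<in> carrier H \<Longrightarrow> \<phi> h \<in> hom N N"
    and one: "\<And>n. n \<in> carrier N \<Longrightarrow> \<phi> \<one>\<^bsub>H\<^esub> n = n"
    and mult: "\<And>h h' n. \<lbrakk>h \<in> carrier H; h' \<in> carrier H; n \<in> carrier N\<rbrakk>
                \<Longrightarrow> \<phi> (h \<otimes>\<^bsub>H\<^esub> h') n = \<phi> h (\<phi> h' n)"
  shows "group (semidirect_product N H \<phi>)"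
proof -
  interpret N: group N by fact
  interpret H: group H by fact
  have closed: "\<phi> h n \<in> carrier N" if "h \<in> carrier H" "n \<in> carrier N" for h n
    using hom_in_carrier[OF hom] that by blast
  have hom_mult: "\<phi> h (n \<otimes>\<^bsub>N\<^esub> n') = \<phi> h n \<otimes>\<^bsub>N\<^esub> \<phi> h n'"
    if "h \<in> carrier H" "n \<in> carrier N" "n' \<in> carrier N" for h n n'
    using Group.hom_mult[OF hom] that by blast
  show ?thesis
  proof (rule groupI)
    fix x assume "x \<in> carrier (semidirect_product N H \<phi>)"
    then obtain n h where x: "x = (n, h)" "n \<in> carrier N" "h \<in> carrier H"
      by auto
    \<comment> \<open>\<open>groupI\<close> asks only for left inverses. The candidate is
      \<open>(\<phi> (inv h) (inv n), inv h)\<close>, and this is the first component of its product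
      with \<open>(n, h)\<close>.\<close>
    have "\<phi> (inv\<^bsub>H\<^esub> h) (inv\<^bsub>N\<^esub> n) \<otimes>\<^bsub>N\<^esub> \<phi> (inv\<^bsub>H\<^esub> h) n = \<phi> (inv\<^bsub>H\<^esub> h) \<one>\<^bsub>N\<^esub>"
      using x by (simp flip: hom_mult)
    also have "\<dots> = \<one>\<^bsub>N\<^esub>"
      using hom_one[OF hom] x assms(1) by simp
    finally show "\<exists>y\<in>carrier (semidirect_product N H \<phi>).
        y \<otimes>\<^bsub>semidirect_product N H \<phi>\<^esub> x = \<one>\<^bsub>semidirect_product N H \<phi>\<^esub>"
      using x by (intro bexI[of _ "(\<phi> (inv\<^bsub>H\<^esub> h) (inv\<^bsub>N\<^esub> n), inv\<^bsub>H\<^esub> h)"]) (auto simp: closed)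
  qed (auto simp: closed hom_mult one mult N.m_assoc H.m_assoc)
qed

lemma snd_hom_semidirect_product: "snd \<in> hom (semidirect_product N H \<phi>) H"
  by (auto simp: hom_def)

lemma base_hom_semidirect_product:
  assumes "group H" and "\<And>n. n \<in> carrier N \<Longrightarrow> \<phi> \<one>\<^bsub>H\<^esub> n = n"
  shows "(\<lambda>n. (n, \<one>\<^bsub>H\<^esub>)) \<in> hom N (semidirect_product N H \<phi>)"
  using assms by (auto simp: hom_def group.is_monoid)


section \<open>Derived series\<close>

lemma (in group) exp_of_derived_Suc_subset:
  assumes "subgroup H G"
  shows "(derived G ^^ Suc n) H \<subseteq> (derived G ^^ n) H"
  using derived_incl[OF subset_refl exp_of_derived_is_subgroup[OF assms]] by simp

lemma (in group) exp_of_derived_antimono: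
  assumes "subgroup H G" "m \<le> n"
  shows "(derived G ^^ n) H \<subseteq> (derived G ^^ m) H"
  using lift_Suc_antimono_le[of "\<lambda>n. (derived G ^^ n) H"] exp_of_derived_Suc_subset assms by blast

lemma (in group) derived_length_trivial:
  assumes "solvable G"
  shows "(derived G ^^ derived_length G) (carrier G) = {\<one>}"
  using assms unfolding solvable_iff_trivial_derived_seq derived_length_def by (rule LeastI_ex)

text \<open>If two consecutive terms agreed, the series would be constant from there on. Since it
  reaches the trivial group, it would already be trivial at \<open>n\<close>, against
  minimality.\<close>

lemma (in group) exp_of_derived_psubset:
  assumes "solvable G" "n < derived_length G"
  shows "(derived G ^^ Suc n) (carrier G) \<subset> (derived G ^^ n) (carrier G)"
proof (rule ccontr)
  assume "\<not> ?thesis"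
  then have fixpoint: "derived G ((derived G ^^ n) (carrier G)) = (derived G ^^ n) (carrier G)"
    using exp_of_derived_Suc_subset[OF subgroup_self, of n] by auto
  have "(derived G ^^ (m + n)) (carrier G) = (derived G ^^ n) (carrier G)" for m
    by (induction m) (use fixpoint in auto)
  \<comment> \<open>With this \<open>m\<close> the exponent \<open>m + n\<close> is the derived
    length, where the series is trivial.\<close>
  from this[of "derived_length G - n"] have "(derived G ^^ n) (carrier G) = {\<one>}"
    using derived_length_trivial assms by simp
  then show False
    using not_less_Least assms(2) unfolding derived_length_def by blast
qed

text \<open>Since the series decreases, one nontrivial term at \<open>n\<close> rules out every
  earlier index as well.\<close>

lemma (in group) derived_length_eqI:
  assumes "(derived G ^^ Suc n) (carrier G) = {\<one>}" "(derived G ^^ n) (carrier G) \<noteq> {\<one>}"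
  shows "derived_length G = Suc n"
  unfolding derived_length_def
proof (rule Least_equality)
  show "(derived G ^^ Suc n) (carrier G) = {\<one>}" by fact
next
  fix m assume m: "(derived G ^^ m) (carrier G) = {\<one>}"
  show "Suc n \<le> m"
  proof (rule ccontr)
    assume "\<not> Suc n \<le> m"
    then have "(derived G ^^ n) (carrier G) \<subseteq> {\<one>}"
      using exp_of_derived_antimono[OF subgroup_self, of m n] m by simp
    then show False
      using assms(2) subgroup.one_closed[OF exp_of_derived_is_subgroup[OF subgroup_self, of n]]
      by blast
  qed
qed


section \<open>Subgroups of polycyclic groups\<close>

text \<open>Division with remainder: the least positive exponent of the generator \<open>c\<close>
  that lands in \<open>S\<close> divides all the others.\<close>

lemma (in group) subgroup_of_cyclic:
  assumes "cyclic_group G" "subgroup S G"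
  shows "\<exists>x\<in>S. S = range (\<lambda>n::int. x [^] n)"
proof -
  obtain c where c: "c \<in> carrier G" "carrier G = range (\<lambda>n::int. c [^] n)"
    using assms(1) cyclic_group by auto
  have gen: "\<exists>n::int. x = c [^] n" if "x \<in> S" for x
    using that subgroup.subset[OF assms(2)] c(2) by auto
  show ?thesis
  proof (cases "\<exists>n::nat. n > 0 \<and> c [^] int n \<in> S")
    case False
    \<comment> \<open>A negative exponent would give a positive one by taking inverses.\<close>
    have "n = 0" if "c [^] n \<in> S" for n :: int
    proof (rule ccontr)
      assume "n \<noteq> 0"
      moreover have "c [^] (- n) \<in> S"
        using subgroup.m_inv_closed[OF assms(2) that] c(1) by (simp add: int_pow_neg)
      ultimately show False
        using False that by (metis neg_0_less_iff_less not_less_iff_gr_or_eq pos_int_cases)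
    qed
    then have "x = \<one>" if "x \<in> S" for x
      using gen[OF that] that by force
    then have "S = {\<one>}"
      using subgroup.one_closed[OF assms(2)] by blast
    then show ?thesis by auto
  next
    case True
    define d where "d = (LEAST n::nat. n > 0 \<and> c [^] int n \<in> S)"
    have d: "d > 0" "c [^] int d \<in> S"
      using LeastI_ex[OF True] unfolding d_def by auto
    have d_le: "d \<le> n" if "n > 0" "c [^] int n \<in> S" for n
      unfolding d_def by (rule Least_le) (use that in simp)
    have pow: "(c [^] int d) [^] n \<in> S" for n :: int
      using subgroup_int_pow_closed[OF assms(2) d(2)] .
    have "x \<in> range (\<lambda>n::int. (c [^] int d) [^] n)" if "x \<in> S" for x
    proof -
      obtain n :: int where n: "x = c [^] n"
        using gen \<open>x \<in> S\<close> by blast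
      have "n mod int d = n + (int d * (- (n div int d)))"
        by (simp add: minus_div_mult_eq_mod[symmetric])
      then have "c [^] (n mod int d) = x \<otimes> (c [^] int d) [^] (- (n div int d))"
        using c(1) by (simp only: n int_pow_pow int_pow_mult)
      then have "c [^] (n mod int d) \<in> S"
        using subgroup.m_closed[OF assms(2) that pow] by simp
      \<comment> \<open>The remainder is an exponent landing in \<open>S\<close> and smaller than
        \<open>d\<close>, so minimality forces it to be zero.\<close>
      moreover have "n mod int d = int (nat (n mod int d))" "nat (n mod int d) < d"
        using d(1) by (simp_all add: nat_less_iff)
      ultimately have "n mod int d = 0"
        using d_le[of "nat (n mod int d)"] by force
      then have "x = (c [^] int d) [^] (n div int d)"
        using c(1) by (metis n int_pow_pow mult_div_mod_eq add.right_neutral)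
      then show ?thesis by blast
    qed
    then show ?thesis
      using pow d(2) by blast
  qed
qed

text \<open>Add to \<open>S\<close> a lift \<open>x\<close> of the generator \<open>y\<close> of the
  image. If \<open>h l\<close> is the \<open>n\<close>-th power of \<open>y\<close>, then
  \<open>l\<close> differs from the \<open>n\<close>-th power of \<open>x\<close> by an element of
  the kernel, which \<open>S\<close> generates.\<close>

lemma (in group_hom) finitely_generated_extension:
  assumes L: "subgroup L G" and S: "finite S" "generate G S = L \<inter> kernel G H h"
    and y: "y \<in> h ` L" "h ` L = range (\<lambda>n::int. y [^]\<^bsub>H\<^esub> n)"
  shows "\<exists>S. finite S \<and> S \<subseteq> carrier G \<and> generate G S = L"
proof -
  obtain x where x: "x \<in> L" "y = h x"
    using y(1) by blast
  note L_carrier = subgroup.mem_carrier[OF L]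
  have "S \<subseteq> L \<inter> kernel G H h"
    unfolding S(2)[symmetric] by (rule subsetI) (rule generate.incl)
  then have sub: "insert x S \<subseteq> L"
    using x(1) by simp
  have "l \<in> generate G (insert x S)" if "l \<in> L" for l
  proof -
    obtain n :: int where n: "h l = y [^]\<^bsub>H\<^esub> n"
      using y(2) \<open>l \<in> L\<close> by blast
    have xn: "x [^] n \<in> L"
      using G.subgroup_int_pow_closed[OF L x(1)] .
    have hxn: "h (x [^] n) = h l"
      using x L_carrier by (simp add: n hom_int_pow)
    have "l \<otimes> inv (x [^] n) \<in> L \<inter> kernel G H h"
      using that xn hxn L_carrier subgroup.m_closed[OF L] subgroup.m_inv_closed[OF L]
      by (auto simp: kernel_def)
    then have "l \<otimes> inv (x [^] n) \<in> generate G (insert x S)"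
      using S(2) G.mono_generate[of S "insert x S"] by blast
    moreover have "x [^] n \<in> generate G (insert x S)"
      using G.subgroup_int_pow_closed[OF G.generate_is_subgroup] generate.incl sub
        subgroup.subset[OF L] by (metis insertI1 subset_trans)
    ultimately have "l \<otimes> inv (x [^] n) \<otimes> x [^] n \<in> generate G (insert x S)"
      by (rule generate.eng)
    then show ?thesis
      using that xn L_carrier by (simp add: G.m_assoc)
  qed
  moreover have "generate G (insert x S) \<subseteq> L"
    using G.generate_subgroup_incl[OF sub L] .
  ultimately have "generate G (insert x S) = L" by blast
  then show ?thesis
    using S(1) sub subgroup.subset[OF L] by (metis finite_insert subset_trans)
qed

text \<open>Induction along the series, with \<open>L\<close> arbitrary because the step passes to
  \<open>L \<inter> K\<close>. The image of \<open>L\<close> in the cyclic factor is cyclic, so one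
  further generator is enough.\<close>

lemma (in group) polycyclic_seq_finitely_generated:
  assumes "polycyclic_seq G H" "subgroup L G" "L \<subseteq> H"
  shows "\<exists>S. finite S \<and> S \<subseteq> carrier G \<and> generate G S = L"
  using assms
proof (induction arbitrary: L)
  case unity
  then have "L = {\<one>}"
    using subgroup.one_closed by blast
  then show ?case
    using generate_one by (intro exI[of _ "{\<one>}"]) simp
next
  case (extension K H)
  let ?H = "G\<lparr>carrier := H\<rparr>"
  interpret GH: group ?H
    using extension.hyps(3) by (rule subgroup_imp_group)
  interpret K: normal K ?H by fact
  interpret Q: group "?H Mod K"
    by (rule K.factorgroup_is_group)
  interpret q: group_hom ?H "?H Mod K" "\<lambda>a. K #>\<^bsub>?H\<^esub> a"
    by unfold_locales (rule K.r_coset_hom_Mod)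
  have LH: "subgroup L ?H"
    using extension.hyps(3) extension.prems by (simp add: subgroup_incl)
  have ker: "L \<inter> kernel ?H (?H Mod K) (\<lambda>a. K #>\<^bsub>?H\<^esub> a) = L \<inter> K"
  proof -
    have "K #>\<^bsub>?H\<^esub> a = K \<longleftrightarrow> a \<in> K" if "a \<in> L" for a
      using GH.coset_join1[OF _ _ K.subgroup_axioms, of a]
        GH.coset_join2[OF _ K.subgroup_axioms, of a] subgroup.mem_carrier[OF LH that] by blast
    then show ?thesis
      using subgroup.mem_carrier[OF LH] unfolding kernel_def one_FactGroup by blast
  qed
  have KG: "subgroup K G"
    using extension.hyps(3) K.subgroup_axioms incl_subgroup by blast
  then obtain S where S: "finite S" "S \<subseteq> carrier G" "generate G S = L \<inter> K"
    using extension.IH[of "L \<inter> K"] extension.prems(1) subgroups_Inter_pair by blast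
  have "S \<subseteq> L \<inter> K"
    unfolding S(3)[symmetric] by (rule subsetI) (rule generate.incl)
  then have "S \<subseteq> H"
    using extension.prems(2) by blast
  \<comment> \<open>The induction hypothesis generates inside \<open>G\<close>, but the quotient map
    lives on \<open>?H\<close>; both notions agree for subsets of \<open>H\<close>.\<close>
  then have gen: "generate ?H S = L \<inter> K"
    using S(3) generate_consistent extension.hyps(3) by simp
  obtain y where y: "y \<in> (\<lambda>a. K #>\<^bsub>?H\<^esub> a) ` L"
      "(\<lambda>a. K #>\<^bsub>?H\<^esub> a) ` L = range (\<lambda>n::int. y [^]\<^bsub>?H Mod K\<^esub> n)"
    using Q.subgroup_of_cyclic[OF extension.hyps(4) q.subgroup_img_is_subgroup[OF LH]] by blast
  obtain S' where S': "finite S'" "S' \<subseteq> carrier ?H" "generate ?H S' = L"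
    using q.finitely_generated_extension[OF LH S(1) gen[folded ker] y] by blast
  then have "generate G S' = L" "S' \<subseteq> carrier G"
    using generate_consistent[OF _ extension.hyps(3), of S'] subgroup.subset[OF extension.hyps(3)]
    by auto
  with S'(1) show ?case by blast
qed


section \<open>Restricted wreath products\<close>

lemma (in group) nontrivial_group_ex:
  assumes "\<not> trivial_group G"
  shows "\<exists>a\<in>carrier G. a \<noteq> \<one>"
  using assms is_group one_closed unfolding trivial_group_def by auto

section \<open>Group structure of the base and of the wreath product\<close>

locale wreath = G: group G + A: comm_group A
  for G :: "('g, 'm) monoid_scheme" and A :: "('a, 'l) monoid_scheme"
begin

abbreviation B where "B \<equiv> sum_group (carrier G) (\<lambda>_. A)"
abbreviation W where "W \<equiv> restricted_wreath A G"

lemma carrier_B: "carrier B = {f \<in> carrier G \<rightarrow>\<^sub>E carrier A. finite {x \<in> carrier G. f x \<noteq> \<one>\<^bsub>A\<^esub>}}"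
  by (simp add: carrier_sum_group)

lemma comm_group_B: "comm_group B"
proof (rule group.group_comm_groupI)
  show "group B" by simp
next
  fix f f' assume "f \<in> carrier B" "f' \<in> carrier B"
  then show "f \<otimes>\<^bsub>B\<^esub> f' = f' \<otimes>\<^bsub>B\<^esub> f"
    by (auto simp: carrier_B PiE_iff A.m_comm intro!: restrict_ext)
qed

sublocale B: comm_group B by (rule comm_group_B)

text \<open>Left multiplication by \<open>g\<close> carries the support of \<open>f\<close> onto
  that of its translate, so finiteness is kept.\<close>

lemma left_translate_closed:
  assumes g: "g \<in> carrier G" and f: "f \<in> carrier B"
  shows "left_translate G g f \<in> carrier B"
proof -
  have "{x \<in> carrier G. f (inv\<^bsub>G\<^esub> g \<otimes>\<^bsub>G\<^esub> x) \<noteq> \<one>\<^bsub>A\<^esub>}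
        \<subseteq> (\<lambda>x. g \<otimes>\<^bsub>G\<^esub> x) ` {x \<in> carrier G. f x \<noteq> \<one>\<^bsub>A\<^esub>}"
  proof
    fix x assume "x \<in> {x \<in> carrier G. f (inv\<^bsub>G\<^esub> g \<otimes>\<^bsub>G\<^esub> x) \<noteq> \<one>\<^bsub>A\<^esub>}"
    then show "x \<in> (\<lambda>x. g \<otimes>\<^bsub>G\<^esub> x) ` {x \<in> carrier G. f x \<noteq> \<one>\<^bsub>A\<^esub>}"
      using g by (intro image_eqI[of _ _ "inv\<^bsub>G\<^esub> g \<otimes>\<^bsub>G\<^esub> x"]) (auto simp: G.m_assoc[symmetric])
  qed
  then have "finite {x \<in> carrier G. f (inv\<^bsub>G\<^esub> g \<otimes>\<^bsub>G\<^esub> x) \<noteq> \<one>\<^bsub>A\<^esub>}"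
    using f by (auto simp: carrier_B intro: finite_subset)
  then show ?thesis
    using g f by (auto simp: carrier_B left_translate_def PiE_iff cong: conj_cong)
qed

lemma left_translate_hom: "g \<in> carrier G \<Longrightarrow> left_translate G g \<in> hom B B"
  using left_translate_closed by (auto simp: hom_def) (auto simp: left_translate_def fun_eq_iff)

lemma left_translate_one: "f \<in> carrier B \<Longrightarrow> left_translate G \<one>\<^bsub>G\<^esub> f = f"
  by (auto simp: left_translate_def carrier_B PiE_iff extensional_def fun_eq_iff)

lemma left_translate_mult:
  "\<lbrakk>g \<in> carrier G; h \<in> carrier G\<rbrakk>
    \<Longrightarrow> left_translate G (g \<otimes>\<^bsub>G\<^esub> h) f = left_translate G g (left_translate G h f)"
  by (auto simp: left_translate_def fun_eq_iff G.inv_mult_group G.m_assoc)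

lemma group_W: "group W"
  unfolding restricted_wreath_def
  by (rule group_semidirect_product)
    (simp_all add: left_translate_hom left_translate_one left_translate_mult)

sublocale W: group W by (rule group_W)

lemma carrier_W: "carrier W = carrier B \<times> carrier G"
  by (simp add: restricted_wreath_def)

lemma one_W: "\<one>\<^bsub>W\<^esub> = (\<one>\<^bsub>B\<^esub>, \<one>\<^bsub>G\<^esub>)"
  by (simp add: restricted_wreath_def)

lemma mult_W: "(f, g) \<otimes>\<^bsub>W\<^esub> (f', g') = (f \<otimes>\<^bsub>B\<^esub> left_translate G g f', g \<otimes>\<^bsub>G\<^esub> g')"
  unfolding restricted_wreath_def by (rule mult_semidirect_product)

sublocale proj: group_hom W G snd
  by unfold_locales (simp add: restricted_wreath_def snd_hom_semidirect_product)

sublocale base: group_hom B W "\<lambda>f. (f, \<one>\<^bsub>G\<^esub>)"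
  unfolding restricted_wreath_def group_hom_def group_hom_axioms_def
  using group_W base_hom_semidirect_product left_translate_one
  by (auto simp: restricted_wreath_def)

section \<open>Derived series of the wreath product\<close>

text \<open>The projection is surjective, and homomorphic images commute with derived subgroups.
  This serves both bounds: elements of the derived series of \<open>G\<close> lift to
  \<open>W\<close>, and a trivial term in \<open>G\<close> confines the term in \<open>W\<close> to
  the base.\<close>

lemma snd_exp_of_derived: "snd ` (derived W ^^ n) (carrier W) = (derived G ^^ n) (carrier G)"
proof -
  have "snd ` carrier W = carrier G"
    using B.one_closed unfolding carrier_W by (metis empty_iff snd_image_times)
  then show ?thesis
    using proj.exp_of_derived_img[of "carrier W" n] by simp
qed

text \<open>The component \<open>f\<close> cancels because the base is abelian, so any lift of
  \<open>g\<close> gives the same commutator.\<close>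

lemma commutator_base:
  assumes f: "f \<in> carrier B" and g: "g \<in> carrier G" and b: "b \<in> carrier B"
  shows "(f, g) \<otimes>\<^bsub>W\<^esub> (b, \<one>\<^bsub>G\<^esub>) \<otimes>\<^bsub>W\<^esub> inv\<^bsub>W\<^esub> (f, g) \<otimes>\<^bsub>W\<^esub> inv\<^bsub>W\<^esub> (b, \<one>\<^bsub>G\<^esub>)
         = (left_translate G g b \<otimes>\<^bsub>B\<^esub> inv\<^bsub>B\<^esub> b, \<one>\<^bsub>G\<^esub>)"
proof -
  let ?c = "(left_translate G g b \<otimes>\<^bsub>B\<^esub> inv\<^bsub>B\<^esub> b, \<one>\<^bsub>G\<^esub>)"
  note closed = left_translate_closed[OF g b] f b B.inv_closed[OF b]
  have mem: "(f, g) \<in> carrier W" "(b, \<one>\<^bsub>G\<^esub>) \<in> carrier W" "?c \<in> carrier W"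
    using closed g B.m_closed unfolding carrier_W by blast+
  \<comment> \<open>No formula for inverses in \<open>W\<close> is needed: the claim is checked
    after multiplying on the right by \<open>(b, \<one>)\<close> and then
    \<open>(f, g)\<close>.\<close>
  have "?c \<otimes>\<^bsub>W\<^esub> (b, \<one>\<^bsub>G\<^esub>) = (left_translate G g b \<otimes>\<^bsub>B\<^esub> inv\<^bsub>B\<^esub> b \<otimes>\<^bsub>B\<^esub> b, \<one>\<^bsub>G\<^esub>)"
    unfolding mult_W left_translate_one[OF b] by simp
  also have "\<dots> = (left_translate G g b, \<one>\<^bsub>G\<^esub>)"
    using closed by (simp only: B.m_assoc B.l_inv B.r_one)
  finally have "?c \<otimes>\<^bsub>W\<^esub> (b, \<one>\<^bsub>G\<^esub>) \<otimes>\<^bsub>W\<^esub> (f, g) = (left_translate G g b \<otimes>\<^bsub>B\<^esub> f, g)"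
    using g by (simp only: mult_W left_translate_one[OF f] G.l_one)
  also have "\<dots> = (f, g) \<otimes>\<^bsub>W\<^esub> (b, \<one>\<^bsub>G\<^esub>)"
    using g closed by (simp only: mult_W G.r_one B.m_comm)
  finally have "(f, g) \<otimes>\<^bsub>W\<^esub> (b, \<one>\<^bsub>G\<^esub>) = ?c \<otimes>\<^bsub>W\<^esub> (b, \<one>\<^bsub>G\<^esub>) \<otimes>\<^bsub>W\<^esub> (f, g)" ..
  then show ?thesis
    using mem by (simp only: W.m_assoc W.r_inv W.r_one W.m_closed W.inv_closed)
qed

lemma single_in_B:
  assumes "a \<in> carrier A"
  shows "(\<lambda>x\<in>carrier G. if x = z then a else \<one>\<^bsub>A\<^esub>) \<in> carrier B"
  using assms by (auto simp: carrier_B intro: finite_subset[of _ "{z}"])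

text \<open>Vanishing is demanded only on the current derived subgroup of \<open>G\<close>, since
  elsewhere the translates enlarge the support.\<close>

lemma exp_of_derived_nontrivial:
  assumes "solvable G" "\<not> trivial_group A" "n \<le> derived_length G"
  shows "\<exists>b. (b, \<one>\<^bsub>G\<^esub>) \<in> (derived W ^^ n) (carrier W) \<and> b \<in> carrier B \<and> b \<one>\<^bsub>G\<^esub> \<noteq> \<one>\<^bsub>A\<^esub> \<and>
           (\<forall>x\<in>(derived G ^^ n) (carrier G). x \<noteq> \<one>\<^bsub>G\<^esub> \<longrightarrow> b x = \<one>\<^bsub>A\<^esub>)"
  using assms(3)
proof (induction n)
  case 0
  obtain a where a: "a \<in> carrier A" "a \<noteq> \<one>\<^bsub>A\<^esub>"
    using A.nontrivial_group_ex[OF assms(2)] by blast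
  define b where "b = (\<lambda>x\<in>carrier G. if x = \<one>\<^bsub>G\<^esub> then a else \<one>\<^bsub>A\<^esub>)"
  have "b \<in> carrier B"
    unfolding b_def using a(1) by (rule single_in_B)
  moreover have "b \<one>\<^bsub>G\<^esub> \<noteq> \<one>\<^bsub>A\<^esub>" "\<forall>x\<in>carrier G. x \<noteq> \<one>\<^bsub>G\<^esub> \<longrightarrow> b x = \<one>\<^bsub>A\<^esub>"
    using a(2) by (simp_all add: b_def)
  ultimately show ?case
    by (intro exI[of _ b]) (simp add: carrier_W)
next
  case (Suc n)
  let ?D = "\<lambda>n. (derived G ^^ n) (carrier G)" and ?E = "\<lambda>n. (derived W ^^ n) (carrier W)"
  note D = G.exp_of_derived_is_subgroup[OF G.subgroup_self]
  obtain b where b: "(b, \<one>\<^bsub>G\<^esub>) \<in> ?E n" "b \<in> carrier B" "b \<one>\<^bsub>G\<^esub> \<noteq> \<one>\<^bsub>A\<^esub>"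
      and b_one: "\<And>x. x \<in> ?D n \<Longrightarrow> x \<noteq> \<one>\<^bsub>G\<^esub> \<Longrightarrow> b x = \<one>\<^bsub>A\<^esub>"
    using Suc by auto
  obtain g where g: "g \<in> ?D n" "g \<notin> ?D (Suc n)"
    using psubset_imp_ex_mem[OF G.exp_of_derived_psubset[OF assms(1), of n]] Suc.prems
    unfolding Suc_le_eq by blast
  obtain f where f: "(f, g) \<in> ?E n"
    using g(1) unfolding snd_exp_of_derived[symmetric] by (elim imageE) (metis prod.collapse)
  have gG: "g \<in> carrier G"
    using g(1) subgroup.subset[OF D] by blast
  have fB: "f \<in> carrier B"
    using f W.exp_of_derived_in_carrier[OF subset_refl, of n] unfolding carrier_W by blast
  define b' where "b' = left_translate G g b \<otimes>\<^bsub>B\<^esub> inv\<^bsub>B\<^esub> b"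
  have b'B: "b' \<in> carrier B"
    unfolding b'_def using left_translate_closed[OF gG b(2)] b(2) by (intro B.m_closed B.inv_closed)
  have "(b', \<one>\<^bsub>G\<^esub>) \<in> derived_set W (?E n)"
    using commutator_base[OF fB gG b(2)] f b(1) unfolding b'_def by force
  then have "(b', \<one>\<^bsub>G\<^esub>) \<in> ?E (Suc n)"
    by (simp add: derived_def generate.incl)
  \<comment> \<open>On the smaller subgroup the translate contributes nothing, so \<open>b'\<close>
    inherits both properties from the pointwise inverse of \<open>b\<close>.\<close>
  moreover have b': "b' x = inv\<^bsub>A\<^esub> (b x)" if x: "x \<in> ?D (Suc n)" for x
  proof -
    have xn: "x \<in> ?D n"
      using x G.exp_of_derived_Suc_subset[OF G.subgroup_self] by blast
    have xG: "x \<in> carrier G"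
      using xn subgroup.subset[OF D] by blast
    have "inv\<^bsub>G\<^esub> g \<otimes>\<^bsub>G\<^esub> x \<in> ?D n"
      using g(1) xn subgroup.m_closed[OF D] subgroup.m_inv_closed[OF D] by blast
    \<comment> \<open>Otherwise \<open>x = g\<close>, but \<open>g\<close> was chosen outside
      \<open>?D (Suc n)\<close>.\<close>
    moreover have "inv\<^bsub>G\<^esub> g \<otimes>\<^bsub>G\<^esub> x \<noteq> \<one>\<^bsub>G\<^esub>"
      using g(2) x xG gG by (metis G.inv_closed G.inv_equality G.inv_inv)
    ultimately have "b (inv\<^bsub>G\<^esub> g \<otimes>\<^bsub>G\<^esub> x) = \<one>\<^bsub>A\<^esub>"
      by (rule b_one)
    moreover have "b x \<in> carrier A"
      using b(2) xG by (auto simp: carrier_B)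
    ultimately show ?thesis
      using xG b(2) by (simp add: b'_def left_translate_def)
  qed
  moreover have "b' \<one>\<^bsub>G\<^esub> \<noteq> \<one>\<^bsub>A\<^esub>"
    using b'[OF subgroup.one_closed[OF D]] b(2,3) by (simp add: carrier_B PiE_iff Pi_iff)
  moreover have "b' x = \<one>\<^bsub>A\<^esub>" if "x \<in> ?D (Suc n)" "x \<noteq> \<one>\<^bsub>G\<^esub>" for x
    using b'[OF that(1)] b_one that G.exp_of_derived_Suc_subset[OF G.subgroup_self, of n] by auto
  ultimately show ?case
    using b'B by blast
qed

text \<open>The term at \<open>?k\<close> projects to the identity of \<open>G\<close> and hence
  lies in the embedded copy of the abelian group \<open>B\<close>; deriving once more kills
  it.\<close>

lemma exp_of_derived_trivial:
  assumes "solvable G"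
  shows "(derived W ^^ Suc (derived_length G)) (carrier W) = {\<one>\<^bsub>W\<^esub>}"
proof -
  let ?k = "derived_length G"
  have "(derived W ^^ ?k) (carrier W) \<subseteq> (\<lambda>f. (f, \<one>\<^bsub>G\<^esub>)) ` carrier B"
  proof
    fix w assume w: "w \<in> (derived W ^^ ?k) (carrier W)"
    then have "snd w = \<one>\<^bsub>G\<^esub>"
      using snd_exp_of_derived[of ?k] G.derived_length_trivial[OF assms] by blast
    moreover have "w \<in> carrier W"
      using w W.exp_of_derived_in_carrier[OF subset_refl] by blast
    ultimately show "w \<in> (\<lambda>f. (f, \<one>\<^bsub>G\<^esub>)) ` carrier B"
      unfolding carrier_W by (cases w) auto
  qed
  then have "derived W ((derived W ^^ ?k) (carrier W)) \<subseteq> derived W ((\<lambda>f. (f, \<one>\<^bsub>G\<^esub>)) ` carrier B)"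
    by (rule W.mono_derived)
  also have "\<dots> = (\<lambda>f. (f, \<one>\<^bsub>G\<^esub>)) ` derived B (carrier B)"
    by (rule base.derived_img) simp
  also have "\<dots> = {\<one>\<^bsub>W\<^esub>}"
    by (simp only: B.derived_eq_singleton[OF subset_refl] one_W image_insert image_empty)
  finally show ?thesis
    using subgroup.one_closed[OF W.exp_of_derived_is_subgroup[OF W.subgroup_self, of "Suc ?k"]]
    by auto
qed

lemma derived_length_W:
  assumes "solvable G" "\<not> trivial_group A"
  shows "derived_length W = Suc (derived_length G)"
proof (rule W.derived_length_eqI[OF exp_of_derived_trivial[OF assms(1)]])
  obtain b where b: "(b, \<one>\<^bsub>G\<^esub>) \<in> (derived W ^^ derived_length G) (carrier W)" "b \<one>\<^bsub>G\<^esub> \<noteq> \<one>\<^bsub>A\<^esub>"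
    using exp_of_derived_nontrivial[OF assms order_refl] by blast
  then have "b \<noteq> \<one>\<^bsub>B\<^esub>" by auto
  then show "(derived W ^^ derived_length G) (carrier W) \<noteq> {\<one>\<^bsub>W\<^esub>}"
    using b(1) unfolding one_W by auto
qed

section \<open>Failure of polycyclicity over an infinite group\<close>

text \<open>The operations of \<open>B\<close> are pointwise, so they preserve vanishing off
  \<open>T\<close>. With \<open>T\<close> the joint support of some generators, this subgroup
  contains all that they generate.\<close>

lemma supported_subgroup:
  "subgroup {(f, \<one>\<^bsub>G\<^esub>) |f. f \<in> carrier B \<and> (\<forall>x\<in>carrier G - T. f x = \<one>\<^bsub>A\<^esub>)} W" (is "subgroup ?T W")
proof -
  have "subgroup {f \<in> carrier B. \<forall>x\<in>carrier G - T. f x = \<one>\<^bsub>A\<^esub>} B" (is "subgroup ?S B")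
  proof (rule B.subgroupI)
    show "{f \<in> carrier B. \<forall>x\<in>carrier G - T. f x = \<one>\<^bsub>A\<^esub>} \<noteq> {}"
      using B.one_closed by (auto simp del: B.one_closed intro!: exI[of _ "\<one>\<^bsub>B\<^esub>"])
  next
    fix f assume "f \<in> {f \<in> carrier B. \<forall>x\<in>carrier G - T. f x = \<one>\<^bsub>A\<^esub>}"
    then show "inv\<^bsub>B\<^esub> f \<in> {f \<in> carrier B. \<forall>x\<in>carrier G - T. f x = \<one>\<^bsub>A\<^esub>}"
      using B.inv_closed[of f] by (auto simp del: B.inv_closed)
  qed (auto simp: B.m_closed[simplified])
  then have "subgroup ((\<lambda>f. (f, \<one>\<^bsub>G\<^esub>)) ` ?S) W"
    by (rule base.subgroup_img_is_subgroup)
  also have "(\<lambda>f. (f, \<one>\<^bsub>G\<^esub>)) ` ?S = ?T"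
    by blast
  finally show ?thesis .
qed

lemma not_polycyclic_W:
  assumes "infinite (carrier G)" "\<not> trivial_group A"
  shows "\<not> polycyclic W"
proof
  let ?B = "(\<lambda>f. (f, \<one>\<^bsub>G\<^esub>)) ` carrier B"
  assume "polycyclic W"
  then have poly: "polycyclic_seq W (carrier W)"
    by (simp only: polycyclic_def)
  have BW: "subgroup ?B W"
    by (rule base.img_is_subgroup)
  obtain S where S: "finite S" "generate W S = ?B"
    using W.polycyclic_seq_finitely_generated[OF poly BW subgroup.subset[OF BW]] by blast
  have SB: "S \<subseteq> ?B"
    unfolding S(2)[symmetric] by (rule subsetI) (rule generate.incl)
  \<comment> \<open>The joint support of the generators: a finite union of finite sets, hence not
    all of the infinite \<open>carrier G\<close>.\<close>
  define T where "T = (\<Union>s\<in>S. {x \<in> carrier G. fst s x \<noteq> \<one>\<^bsub>A\<^esub>})"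
  have "finite T"
    unfolding T_def using S(1) SB by (auto simp: carrier_B)
  then obtain z where z: "z \<in> carrier G" "z \<notin> T"
    using assms(1) by (meson ex_new_if_finite finite_subset subsetI)
  obtain a where a: "a \<in> carrier A" "a \<noteq> \<one>\<^bsub>A\<^esub>"
    using A.nontrivial_group_ex[OF assms(2)] by blast
  let ?d = "\<lambda>x\<in>carrier G. if x = z then a else \<one>\<^bsub>A\<^esub>"
  let ?T = "{(f, \<one>\<^bsub>G\<^esub>) |f. f \<in> carrier B \<and> (\<forall>x\<in>carrier G - T. f x = \<one>\<^bsub>A\<^esub>)}"
  have "s \<in> ?T" if "s \<in> S" for s
  proof -
    obtain f where "f \<in> carrier B" "s = (f, \<one>\<^bsub>G\<^esub>)"
      using SB \<open>s \<in> S\<close> by blast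
    moreover from this have "\<forall>x\<in>carrier G - T. f x = \<one>\<^bsub>A\<^esub>"
      using \<open>s \<in> S\<close> unfolding T_def by force
    ultimately show ?thesis by blast
  qed
  then have "?B \<subseteq> ?T"
    unfolding S(2)[symmetric] by (intro W.generate_subgroup_incl[OF _ supported_subgroup]) blast
  \<comment> \<open>The function concentrated at \<open>z\<close> lies in the base, yet
    \<open>z\<close> is outside \<open>T\<close>, where members of \<open>?T\<close> must be
    trivial.\<close>
  then have "(?d, \<one>\<^bsub>G\<^esub>) \<in> ?T"
    using imageI[OF single_in_B[OF a(1), of z]] by (rule subsetD)
  then have "?d z = \<one>\<^bsub>A\<^esub>"
    using z by blast
  then show False
    using z a by simp
qed

end

text \<open>Nontriviality of \<open>A\<close> is essential: for trivial \<open>A\<close> the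
  projection onto \<open>G\<close> is an isomorphism, and the derived length stays
  \<open>k\<close>.\<close>

theorem lemma7p2:
  fixes G :: "('g, 'm) monoid_scheme"
    and A :: "('a, 'l) monoid_scheme"
    and k :: nat
  assumes "group G" and "solvable G" and "derived_length G = k"
    and "comm_group A" and "\<not> trivial_group A"
  shows "group (restricted_wreath A G) \<and> solvable (restricted_wreath A G) \<and>
           derived_length (restricted_wreath A G) = k + 1 \<and>
         (infinite (carrier G) \<longrightarrow> \<not> polycyclic (restricted_wreath A G))"
proof -
  interpret wreath G A
    using assms by (simp add: wreath_def)
  have "solvable W"
    unfolding W.solvable_iff_trivial_derived_seq using exp_of_derived_trivial[OF assms(2)] by blast
  then show ?thesis
    using group_W derived_length_W[OF assms(2,5)] not_polycyclic_W assms(3,5) by simp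
qed

end
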